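(* The function \[ F_0(k,a,b,c,d) = (-1)^{c+d}\,\frac{\Gamma(a+k)\Gamma(b+k)}{\Gamma(c+k)\Gamma(d+k)}\cdot\frac{\Gamma(a+b-c-d+2)}{\Gamma(a-c+1)\Gamma(a-d+1)\Gamma(b-c+1)\Gamma(b-d+1)} \] is a WZ seed in the variables $a,b,c,d$.
   Context: A term $F(n_1,\dots,n_r)$ is hypergeometric in $n_1,\dots,n_r$ if each ratio $F(\dots,n_i+1,\dots)/F(\dots,n_i,\dots)$ is a rational function of $n_1,\dots,n_r$. Write $\Delta_n f(n)=f(n+1)-f(n)$. Two hypergeometric terms $F(n,k),G(n,k)$ form a WZ pair, and $G$ is called a WZ mate of $F$, if $\Delta_n F(n,k)=\Delta_k G(n,k)$. A hypergeometric term $F_0(k,a,b,\dots)$ (hypergeometric in $k,a,b,\dots$) is a WZ seed in the variables $a,b,\dots$ if for all integers $K,A,B,\dots$ and all complex $k_0$ and all values of the parameters $a,b,\dots$, the term $F(n,k)=F_0(Kn+k_0+k,\,An+a,\,Bn+b,\dots)$ has a WZ mate $G(n,k)$ (a hypergeometric term). Factors such as $(-1)^x$ or $z^x$ with non-integer exponent $x$ are understood as hypergeometric factors satisfying $(-1)^{x+1}=-(-1)^x$, $z^{x+1}=z\cdot z^x$ (e.g. defined via a fixed branch of the exponential). *)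

theory Defs
  imports "HOL-Analysis.Analysis"
begin

text \<open>Bivariate polynomials with complex coefficients are represented as
  nested univariate polynomials; \<open>poly2 P x y\<close> evaluates \<open>P\<close> at \<open>(x,y)\<close>
  (outer variable \<open>x\<close>, inner variable \<open>y\<close>).\<close>
definition poly2 :: "complex poly poly \<Rightarrow> complex \<Rightarrow> complex \<Rightarrow> complex" where
  "poly2 P x y = poly (map_poly (\<lambda>q. poly q y) P) x"

definition hypergeometric2 :: "(int \<Rightarrow> int \<Rightarrow> complex) \<Rightarrow> bool" where
  "hypergeometric2 G \<longleftrightarrow>
     (\<exists>P Q. Q \<noteq> 0 \<and> (\<forall>n k. poly2 Q (of_int n) (of_int k) * G (n + 1) k
                                = poly2 P (of_int n) (of_int k) * G n k)) \<and>
     (\<exists>P Q. Q \<noteq> 0 \<and> (\<forall>n k. poly2 Q (of_int n) (of_int k) * G n (k + 1)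
                                = poly2 P (of_int n) (of_int k) * G n k))"

definition wz_pair :: "(int \<Rightarrow> int \<Rightarrow> complex) \<Rightarrow> (int \<Rightarrow> int \<Rightarrow> complex) \<Rightarrow> bool" where
  "wz_pair F G \<longleftrightarrow> (\<forall>n k. F (n + 1) k - F n k = G n (k + 1) - G n k)"

definition has_wz_mate :: "(int \<Rightarrow> int \<Rightarrow> complex) \<Rightarrow> bool" where
  "has_wz_mate F \<longleftrightarrow> (\<exists>G. hypergeometric2 G \<and> wz_pair F G)"

text \<open>The branch \<open>(-1)^x = exp(i \<pi> x)\<close>, so that \<open>(-1)^(x+1) = -(-1)^x\<close>.\<close>
definition neg1pow :: "complex \<Rightarrow> complex" where
  "neg1pow x = exp (\<i> * of_real pi * x)"

text \<open>The term \<open>F\<^sub>0(k,a,b,c,d)\<close>; reciprocal Gamma factors are written with the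
  entire function \<open>rGamma = 1/\<Gamma>\<close>.\<close>
definition F0 :: "complex \<Rightarrow> complex \<Rightarrow> complex \<Rightarrow> complex \<Rightarrow> complex \<Rightarrow> complex" where
  "F0 k a b c d = neg1pow (c + d) * Gamma (a + k) * Gamma (b + k) * rGamma (c + k) * rGamma (d + k)
     * Gamma (a + b - c - d + 2)
     * rGamma (a - c + 1) * rGamma (a - d + 1) * rGamma (b - c + 1) * rGamma (b - d + 1)"

end

theory Submission
  imports Defs
begin

text \<open>
  A unit step in one of the parameters of \<open>F\<^sub>0\<close> is a difference in \<open>k\<close> of an explicit
  term: for instance \<open>F\<^sub>0(k, a + 1, b, c, d) - F\<^sub>0(k, a, b, c, d) = G(k + 1) - G(k)\<close> with
  \<open>G = (b - c + 1) (b - d + 1) F\<^sub>0'(k, a, b, c - 1, d - 1)\<close>, where \<open>F\<^sub>0'\<close> is \<open>F\<^sub>0\<close> with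
  \<open>\<Gamma>(a + b - c - d + 2)\<close> replaced by \<open>\<Gamma>(a + b - c - d)\<close>; the steps in \<open>b, c, d\<close> are similar.
  Summing these identities along a lattice path from \<open>(a, b, c, d)\<close> to
  \<open>(a + A, b + B, c + C, d + D)\<close>, and telescoping the shift \<open>k \<mapsto> k + K\<close>, gives a WZ mate of
  \<open>F(n, k) = F\<^sub>0(Kn + k\<^sub>0 + k, An + a, \<dots>)\<close>. The path first takes all steps that increase
  \<open>a + b - c - d\<close> and then all that decrease it, so the argument of \<open>\<Gamma>(a + b - c - d + 2)\<close>
  stays between its values at \<open>n\<close> and \<open>n + 1\<close> and never meets a pole. Every term of the
  mate is a polynomial in \<open>n, k\<close> times one fixed product of Gamma factors with arguments
  affine in \<open>n, k\<close>; that product is hypergeometric, hence so is the mate.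
\<close>

section \<open>Polynomial functions on the integer lattice\<close>

type_synonym lattice_term = "int \<Rightarrow> int \<Rightarrow> complex"
type_synonym seed_term = "complex \<Rightarrow> complex \<Rightarrow> complex \<Rightarrow> complex \<Rightarrow> complex \<Rightarrow> complex"

lemma poly2_pCons: "poly2 (pCons q P) x y = poly q y + x * poly2 P x y"
  by (simp add: poly2_def map_poly_pCons)

lemma poly2_0 [simp]: "poly2 0 x y = 0"
  by (simp add: poly2_def)

lemma poly2_add: "poly2 (P + Q) x y = poly2 P x y + poly2 Q x y"
proof (induction P arbitrary: Q)
  case (pCons p P)
  then show ?case by (cases Q) (simp add: poly2_pCons algebra_simps)
qed simp

lemma poly2_smult: "poly2 (smult q P) x y = poly q y * poly2 P x y"
  by (induction P) (simp_all add: poly2_pCons algebra_simps)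

lemma poly2_mult: "poly2 (P * Q) x y = poly2 P x y * poly2 Q x y"
  by (induction P) (simp_all add: poly2_pCons poly2_add poly2_smult algebra_simps)

lemma poly_eq_0_on_Ints:
  fixes p :: "'a::{idom,ring_char_0} poly"
  assumes "\<And>n::int. poly p (of_int n) = 0"
  shows "p = 0"
proof (rule ccontr)
  assume "p \<noteq> 0"
  then have "finite {x. poly p x = 0}" by (rule poly_roots_finite)
  moreover have "range (of_int :: int \<Rightarrow> 'a) \<subseteq> {x. poly p x = 0}" using assms by auto
  moreover have "infinite (range (of_int :: int \<Rightarrow> 'a))"
    by (simp add: finite_image_iff inj_on_def)
  ultimately show False by (meson finite_subset)
qed

lemma poly2_eq_0_on_lattice:
  assumes "\<And>n k::int. poly2 P (of_int n) (of_int k) = 0"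
  shows "P = 0"
proof (rule poly_eqI)
  fix i
  have "map_poly (\<lambda>q. poly q (of_int k)) P = 0" for k :: int
    using assms[of _ k] by (intro poly_eq_0_on_Ints) (simp add: poly2_def)
  then have "poly (coeff P i) (of_int k) = 0" for k :: int
    by (metis coeff_0 coeff_map_poly poly_0)
  then show "coeff P i = coeff 0 i" by (simp add: poly_eq_0_on_Ints)
qed

definition lattice_poly :: "lattice_term \<Rightarrow> bool" where
  "lattice_poly f \<longleftrightarrow> (\<exists>P. \<forall>n k. f n k = poly2 P (of_int n) (of_int k))"

lemma lattice_poly_const: "lattice_poly (\<lambda>n k. c)"
  unfolding lattice_poly_def by (intro exI[of _ "[:[:c:]:]"]) (simp add: poly2_pCons)

lemma lattice_poly_n: "lattice_poly (\<lambda>n k. of_int n)"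
  unfolding lattice_poly_def by (intro exI[of _ "[:0, 1:]"]) (simp add: poly2_pCons)

lemma lattice_poly_k: "lattice_poly (\<lambda>n k. of_int k)"
  unfolding lattice_poly_def by (intro exI[of _ "[:[:0, 1:]:]"]) (simp add: poly2_pCons)

lemma lattice_poly_add: "lattice_poly f \<Longrightarrow> lattice_poly g \<Longrightarrow> lattice_poly (\<lambda>n k. f n k + g n k)"
  unfolding lattice_poly_def by (metis poly2_add)

lemma lattice_poly_mult: "lattice_poly f \<Longrightarrow> lattice_poly g \<Longrightarrow> lattice_poly (\<lambda>n k. f n k * g n k)"
  unfolding lattice_poly_def by (metis poly2_mult)

lemma lattice_poly_diff: "lattice_poly f \<Longrightarrow> lattice_poly g \<Longrightarrow> lattice_poly (\<lambda>n k. f n k - g n k)"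
  using lattice_poly_add[OF _ lattice_poly_mult[OF lattice_poly_const[of "-1"]]] by simp

lemma lattice_poly_poly: "lattice_poly f \<Longrightarrow> lattice_poly (\<lambda>n k. poly p (f n k))"
  by (induction p) (auto intro!: lattice_poly_add lattice_poly_mult lattice_poly_const)

lemma lattice_poly_poly2:
  "lattice_poly f \<Longrightarrow> lattice_poly g \<Longrightarrow> lattice_poly (\<lambda>n k. poly2 P (f n k) (g n k))"
  by (induction P)
    (auto simp: poly2_pCons intro!: lattice_poly_add lattice_poly_mult lattice_poly_poly lattice_poly_const)

lemma lattice_poly_shift: "lattice_poly f \<Longrightarrow> lattice_poly (\<lambda>n k. f (n + dn) (k + dk))"
proof -
  assume "lattice_poly f"
  then obtain P where "\<And>n k. f n k = poly2 P (of_int n) (of_int k)"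
    unfolding lattice_poly_def by blast
  moreover have "lattice_poly (\<lambda>n k. poly2 P (of_int n + of_int dn) (of_int k + of_int dk))"
    by (intro lattice_poly_poly2 lattice_poly_add lattice_poly_n lattice_poly_k lattice_poly_const)
  ultimately show ?thesis by simp
qed

lemma lattice_poly_pochhammer: "lattice_poly f \<Longrightarrow> lattice_poly (\<lambda>n k. pochhammer (f n k) d)"
  by (induction d)
    (auto simp: pochhammer_Suc intro!: lattice_poly_mult lattice_poly_add lattice_poly_const)

definition lattice_affine :: "lattice_term \<Rightarrow> bool" where
  "lattice_affine L \<longleftrightarrow> (\<exists>\<alpha> \<beta> :: int. \<exists>z. \<forall>n k. L n k = of_int (\<alpha> * n + \<beta> * k) + z)"

lemma lattice_affine_const: "lattice_affine (\<lambda>n k. z)"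
  unfolding lattice_affine_def by (rule exI[of _ 0], rule exI[of _ 0], rule exI[of _ z]) simp

lemma lattice_affine_linear: "lattice_affine (\<lambda>n k. of_int (\<alpha> * n) + z)"
  unfolding lattice_affine_def by (rule exI[of _ \<alpha>], rule exI[of _ 0], rule exI[of _ z]) simp

lemma
  assumes "lattice_affine L" "lattice_affine L'"
  shows lattice_affine_add: "lattice_affine (\<lambda>n k. L n k + L' n k)"
    and lattice_affine_diff: "lattice_affine (\<lambda>n k. L n k - L' n k)"
proof -
  obtain \<alpha> \<beta> z \<alpha>' \<beta>' z' where "\<And>n k. L n k = of_int (\<alpha> * n + \<beta> * k) + z"
    "\<And>n k. L' n k = of_int (\<alpha>' * n + \<beta>' * k) + z'"
    using assms unfolding lattice_affine_def by metis
  then show "lattice_affine (\<lambda>n k. L n k + L' n k)" "lattice_affine (\<lambda>n k. L n k - L' n k)"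
    unfolding lattice_affine_def
    by (intro exI[of _ "\<alpha> + \<alpha>'"] exI[of _ "\<beta> + \<beta>'"] exI[of _ "z + z'"], simp add: algebra_simps,
        intro exI[of _ "\<alpha> - \<alpha>'"] exI[of _ "\<beta> - \<beta>'"] exI[of _ "z - z'"], simp add: algebra_simps)
qed

lemma lattice_affine_lattice_poly:
  assumes "lattice_affine L"
  shows "lattice_poly L"
proof -
  obtain \<alpha> \<beta> z where "\<And>n k. L n k = of_int (\<alpha> * n + \<beta> * k) + z"
    using assms unfolding lattice_affine_def by blast
  then have "L = (\<lambda>n k. of_int \<alpha> * of_int n + of_int \<beta> * of_int k + z)"
    by (simp add: fun_eq_iff)
  moreover have "lattice_poly (\<lambda>n k. of_int \<alpha> * of_int n + of_int \<beta> * of_int k + z)"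
    by (intro lattice_poly_add lattice_poly_mult lattice_poly_n lattice_poly_k lattice_poly_const)
  ultimately show ?thesis by simp
qed

section \<open>Hypergeometric terms\<close>

definition hypergeometric_dir :: "lattice_term \<Rightarrow> int \<Rightarrow> int \<Rightarrow> bool" where
  "hypergeometric_dir G dn dk \<longleftrightarrow>
     (\<exists>P Q. Q \<noteq> 0 \<and> (\<forall>n k. poly2 Q (of_int n) (of_int k) * G (n + dn) (k + dk)
                              = poly2 P (of_int n) (of_int k) * G n k))"

lemma hypergeometric2_iff_dir:
  "hypergeometric2 G \<longleftrightarrow> hypergeometric_dir G 1 0 \<and> hypergeometric_dir G 0 1"
  by (simp add: hypergeometric2_def hypergeometric_dir_def)

lemma hypergeometric2I: "(\<And>dn dk. hypergeometric_dir G dn dk) \<Longrightarrow> hypergeometric2 G"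
  by (simp add: hypergeometric2_iff_dir)

lemma hypergeometric_dirI:
  assumes "lattice_poly q" "lattice_poly p" "q n0 k0 \<noteq> 0"
    and "\<And>n k. q n k * G (n + dn) (k + dk) = p n k * G n k"
  shows "hypergeometric_dir G dn dk"
proof -
  obtain Q P where "\<And>n k. q n k = poly2 Q (of_int n) (of_int k)"
    "\<And>n k. p n k = poly2 P (of_int n) (of_int k)"
    using assms(1,2) unfolding lattice_poly_def by metis
  with assms(3,4) show ?thesis
    unfolding hypergeometric_dir_def by (metis poly2_0)
qed

lemma hypergeometric_dir_mult:
  assumes "hypergeometric_dir F dn dk" "hypergeometric_dir G dn dk"
  shows "hypergeometric_dir (\<lambda>n k. F n k * G n k) dn dk"
proof -
  obtain P1 Q1 P2 Q2 where "Q1 \<noteq> 0" "Q2 \<noteq> 0"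
    and F: "\<And>n k. poly2 Q1 (of_int n) (of_int k) * F (n + dn) (k + dk)
                    = poly2 P1 (of_int n) (of_int k) * F n k"
    and G: "\<And>n k. poly2 Q2 (of_int n) (of_int k) * G (n + dn) (k + dk)
                    = poly2 P2 (of_int n) (of_int k) * G n k"
    using assms unfolding hypergeometric_dir_def by metis
  have "poly2 (Q1 * Q2) (of_int n) (of_int k) * (F (n + dn) (k + dk) * G (n + dn) (k + dk))
      = poly2 (P1 * P2) (of_int n) (of_int k) * (F n k * G n k)" for n k
    using F[of n k] G[of n k] by (simp add: poly2_mult) (metis mult.assoc mult.left_commute)
  with \<open>Q1 \<noteq> 0\<close> \<open>Q2 \<noteq> 0\<close> show ?thesis
    unfolding hypergeometric_dir_def by (metis mult_eq_0_iff)
qed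

lemma hypergeometric_dir_lattice_poly:
  assumes "lattice_poly g"
  shows "hypergeometric_dir g dn dk"
proof -
  obtain P where P: "\<And>n k. g n k = poly2 P (of_int n) (of_int k)"
    using assms unfolding lattice_poly_def by blast
  show ?thesis
  proof (cases "P = 0")
    case True
    then show ?thesis
      unfolding hypergeometric_dir_def by (intro exI[of _ 0] exI[of _ 1]) (simp add: P)
  next
    case False
    obtain P' where "\<And>n k. g (n + dn) (k + dk) = poly2 P' (of_int n) (of_int k)"
      using lattice_poly_shift[OF assms] unfolding lattice_poly_def by blast
    with False show ?thesis
      unfolding hypergeometric_dir_def by (intro exI[of _ P'] exI[of _ P]) (simp add: P)
  qed
qed

lemma hypergeometric_dir_inverse:
  assumes "hypergeometric_dir G dn dk" "\<And>n k. G n k \<noteq> 0"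
  shows "hypergeometric_dir (\<lambda>n k. inverse (G n k)) dn dk"
proof -
  obtain P Q where "Q \<noteq> 0"
    and rel: "\<And>n k. poly2 Q (of_int n) (of_int k) * G (n + dn) (k + dk)
                      = poly2 P (of_int n) (of_int k) * G n k"
    using assms(1) unfolding hypergeometric_dir_def by blast
  have "P \<noteq> 0"
  proof
    assume "P = 0"
    then have "poly2 Q (of_int n) (of_int k) = 0" for n k
      using rel[of n k] assms(2)[of "n + dn" "k + dk"] by simp
    then show False using \<open>Q \<noteq> 0\<close> poly2_eq_0_on_lattice by blast
  qed
  moreover have "poly2 P (of_int n) (of_int k) * inverse (G (n + dn) (k + dk))
      = poly2 Q (of_int n) (of_int k) * inverse (G n k)" for n k
    using rel[of n k] assms(2)[of n k] assms(2)[of "n + dn" "k + dk"] by (simp add: field_simps)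
  ultimately show ?thesis
    unfolding hypergeometric_dir_def by blast
qed

lemma hypergeometric2_mult:
  "hypergeometric2 F \<Longrightarrow> hypergeometric2 G \<Longrightarrow> hypergeometric2 (\<lambda>n k. F n k * G n k)"
  by (simp add: hypergeometric2_iff_dir hypergeometric_dir_mult)

lemma hypergeometric2_lattice_poly: "lattice_poly g \<Longrightarrow> hypergeometric2 g"
  by (simp add: hypergeometric2_iff_dir hypergeometric_dir_lattice_poly)

lemma poly_shift_relation_succ:
  fixes h :: "'a::idom \<Rightarrow> 'a"
  assumes "\<And>w. poly p w * h (w + 1) = poly q w * h w"
    and "\<And>w. poly Q w * h (w + of_int i) = poly P w * h w"
  defines "s \<equiv> [:of_int i, 1:]"
  shows "poly (Q * pcompose p s) w * h (w + of_int (i + 1)) = poly (P * pcompose q s) w * h w"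
proof -
  have "poly (Q * pcompose p s) w * h (w + of_int (i + 1))
      = poly Q w * (poly p (w + of_int i) * h (w + of_int i + 1))"
    by (simp add: s_def poly_pcompose algebra_simps)
  also have "\<dots> = poly Q w * h (w + of_int i) * poly q (w + of_int i)"
    by (simp add: assms(1))
  also have "\<dots> = poly (P * pcompose q s) w * h w"
    by (simp add: assms(2) s_def poly_pcompose algebra_simps)
  finally show ?thesis .
qed

lemma poly_shift_relation_pred:
  fixes h :: "'a::idom \<Rightarrow> 'a"
  assumes "\<And>w. poly p w * h (w + 1) = poly q w * h w"
    and "\<And>w. poly Q w * h (w + of_int i) = poly P w * h w"
  defines "s \<equiv> [:of_int i - 1, 1:]"
  shows "poly (Q * pcompose q s) w * h (w + of_int (i - 1)) = poly (P * pcompose p s) w * h w"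
proof -
  have "poly (Q * pcompose q s) w * h (w + of_int (i - 1))
      = poly Q w * (poly q (w + of_int i - 1) * h (w + of_int i - 1))"
    by (simp add: s_def poly_pcompose algebra_simps)
  also have "\<dots> = poly Q w * h (w + of_int i) * poly p (w + of_int i - 1)"
    using assms(1)[of "w + of_int i - 1"] by (simp add: algebra_simps)
  also have "\<dots> = poly (P * pcompose p s) w * h w"
    by (simp add: assms(2) s_def poly_pcompose algebra_simps)
  finally show ?thesis .
qed

lemma poly_shift_relation:
  fixes h :: "'a::idom \<Rightarrow> 'a"
  assumes "p \<noteq> 0" "q \<noteq> 0" "\<And>w. poly p w * h (w + 1) = poly q w * h w"
  shows "\<exists>Q P. Q \<noteq> 0 \<and> (\<forall>w. poly Q w * h (w + of_int j) = poly P w * h w)"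
proof (induction j rule: int_induct[where k = 0])
  case base
  show ?case by (intro exI[of _ 1]) simp
next
  case (step1 i)
  then obtain Q P where "Q \<noteq> 0" and QP: "\<And>w. poly Q w * h (w + of_int i) = poly P w * h w"
    by blast
  then have "Q * pcompose p [:of_int i, 1:] \<noteq> 0"
    using assms(1) by (simp add: pcompose_eq_0_iff)
  with poly_shift_relation_succ[OF assms(3) QP] show ?case by blast
next
  case (step2 i)
  then obtain Q P where "Q \<noteq> 0" and QP: "\<And>w. poly Q w * h (w + of_int i) = poly P w * h w"
    by blast
  then have "Q * pcompose q [:of_int i - 1, 1:] \<noteq> 0"
    using assms(2) by (simp add: pcompose_eq_0_iff)
  with poly_shift_relation_pred[OF assms(3) QP] show ?case by blast
qed

lemma hypergeometric2_comp_affine: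
  fixes h :: "complex \<Rightarrow> complex"
  assumes "lattice_affine L" "p \<noteq> 0" "q \<noteq> 0" "\<And>w. poly p w * h (w + 1) = poly q w * h w"
  shows "hypergeometric2 (\<lambda>n k. h (L n k))"
proof (rule hypergeometric2I)
  fix dn dk :: int
  obtain \<alpha> \<beta> z where L: "\<And>n k. L n k = of_int (\<alpha> * n + \<beta> * k) + z"
    using assms(1) unfolding lattice_affine_def by blast
  define j where "j = \<alpha> * dn + \<beta> * dk"
  have shift: "L (n + dn) (k + dk) = L n k + of_int j" for n k
    by (simp add: L j_def algebra_simps)
  show "hypergeometric_dir (\<lambda>n k. h (L n k)) dn dk"
  proof (cases "j = 0")
    case True
    then show ?thesis
      by (intro hypergeometric_dirI[of "\<lambda>_ _. 1" "\<lambda>_ _. 1" 0 0])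
        (simp_all add: shift lattice_poly_const)
  next
    case False
    obtain Q P where "Q \<noteq> 0" and QP: "\<And>w. poly Q w * h (w + of_int j) = poly P w * h w"
      using poly_shift_relation[OF assms(2-4)] by blast
    have "\<exists>t. poly Q (L (t * dn) (t * dk)) \<noteq> 0"
    proof (rule ccontr)
      assume "\<not> ?thesis"
      moreover have "L (t * dn) (t * dk) = poly [:z, of_int j:] (of_int t)" for t
        by (simp add: L j_def algebra_simps)
      ultimately have "poly (pcompose Q [:z, of_int j:]) (of_int t) = 0" for t
        by (simp add: poly_pcompose)
      then have "pcompose Q [:z, of_int j:] = 0" by (rule poly_eq_0_on_Ints)
      with False \<open>Q \<noteq> 0\<close> show False by (simp add: pcompose_eq_0_iff)
    qed
    then obtain t where "poly Q (L (t * dn) (t * dk)) \<noteq> 0" ..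
    with lattice_affine_lattice_poly[OF assms(1)] show ?thesis
      by (intro hypergeometric_dirI[of "\<lambda>n k. poly Q (L n k)" "\<lambda>n k. poly P (L n k)"])
         (simp_all add: lattice_poly_poly shift QP)
  qed
qed

lemma neg1pow_add: "neg1pow (w + z) = neg1pow w * neg1pow z"
  by (simp add: neg1pow_def distrib_left exp_add)

lemma neg1pow_plus1: "neg1pow (w + 1) = - neg1pow w"
  by (simp add: neg1pow_add) (simp add: neg1pow_def)

lemma hypergeometric2_neg1pow: "lattice_affine L \<Longrightarrow> hypergeometric2 (\<lambda>n k. neg1pow (L n k))"
  by (rule hypergeometric2_comp_affine[where p = 1 and q = "-1"]) (simp_all add: neg1pow_plus1)

lemma hypergeometric2_rGamma: "lattice_affine L \<Longrightarrow> hypergeometric2 (\<lambda>n k. rGamma (L n k))"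
  by (rule hypergeometric2_comp_affine[where p = "[:0, 1:]" and q = 1]) (simp_all add: rGamma_plus1)

lemma hypergeometric2_Gamma:
  assumes "lattice_affine L" "\<And>n k. L n k \<notin> \<int>\<^sub>\<le>\<^sub>0"
  shows "hypergeometric2 (\<lambda>n k. Gamma (L n k))"
  using hypergeometric2_rGamma[OF assms(1)] rGamma_nonzero[OF assms(2)]
  unfolding Gamma_def hypergeometric2_iff_dir by (simp add: hypergeometric_dir_inverse)

section \<open>Signed sums and polynomial multiples\<close>

definition signed_sum :: "int \<Rightarrow> (int \<Rightarrow> 'a::ab_group_add) \<Rightarrow> 'a" where
  "signed_sum j f = (if 0 \<le> j then (\<Sum>i\<in>{0..<j}. f i) else - (\<Sum>i\<in>{j..<0}. f i))"

lemma signed_sum_plus1: "signed_sum (j + 1) f = signed_sum j f + f j"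
proof (cases "0 \<le> j")
  case True
  then have "{0..<j + 1} = insert j {0..<j}" by auto
  with True show ?thesis by (simp add: signed_sum_def)
next
  case False
  then have "{j..<0} = insert j {j + 1..<0}" by auto
  with False show ?thesis by (auto simp: signed_sum_def)
qed

lemma signed_sum_diff: "signed_sum j (\<lambda>i. f i - g i) = signed_sum j f - signed_sum j g"
  by (simp add: signed_sum_def sum_subtractf)

lemma signed_sum_telescope:
  assumes "\<And>i. min 0 j \<le> i \<Longrightarrow> i < max 0 j \<Longrightarrow> \<phi> (i + 1) - \<phi> i = f i"
  shows "\<phi> j - \<phi> 0 = signed_sum j f"
  using assms
proof (induction j rule: int_induct[where k = 0])
  case base
  then show ?case by (simp add: signed_sum_def)
next
  case (step1 i)
  have "\<phi> (i + 1) - \<phi> 0 = (\<phi> i - \<phi> 0) + (\<phi> (i + 1) - \<phi> i)" by simp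
  also have "\<dots> = signed_sum i f + f i" using step1 by auto
  finally show ?case by (simp add: signed_sum_plus1)
next
  case (step2 i)
  have "\<phi> (i - 1) - \<phi> 0 = (\<phi> i - \<phi> 0) - (\<phi> (i - 1 + 1) - \<phi> (i - 1))" by simp
  also have "\<dots> = signed_sum i f - f (i - 1)"
    using step2 step2.prems[of "i - 1"] by auto
  finally show ?case using signed_sum_plus1[of "i - 1" f] by simp
qed

definition poly_multiple :: "lattice_term \<Rightarrow> lattice_term \<Rightarrow> bool" where
  "poly_multiple f T \<longleftrightarrow> (\<exists>g. lattice_poly g \<and> (\<forall>n k. f n k = g n k * T n k))"

lemma hypergeometric2_poly_multiple:
  assumes "poly_multiple f T" "hypergeometric2 T"
  shows "hypergeometric2 f"
proof -
  obtain g where "lattice_poly g" and "\<And>n k. f n k = g n k * T n k"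
    using assms(1) unfolding poly_multiple_def by blast
  then have "f = (\<lambda>n k. g n k * T n k)" by (simp add: fun_eq_iff)
  with \<open>lattice_poly g\<close> assms(2) show ?thesis
    by (simp add: hypergeometric2_mult hypergeometric2_lattice_poly)
qed

lemma poly_multiple_add:
  assumes "poly_multiple f T" "poly_multiple f' T"
  shows "poly_multiple (\<lambda>n k. f n k + f' n k) T"
proof -
  obtain g g' where "lattice_poly g" "lattice_poly g'"
    and "\<And>n k. f n k = g n k * T n k" "\<And>n k. f' n k = g' n k * T n k"
    using assms unfolding poly_multiple_def by blast
  then show ?thesis unfolding poly_multiple_def
    by (intro exI[of _ "\<lambda>n k. g n k + g' n k"]) (simp add: lattice_poly_add distrib_right)
qed

lemma poly_multiple_lattice_poly_mult:
  assumes "lattice_poly h" "poly_multiple f T"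
  shows "poly_multiple (\<lambda>n k. h n k * f n k) T"
proof -
  obtain g where "lattice_poly g" and "\<And>n k. f n k = g n k * T n k"
    using assms(2) unfolding poly_multiple_def by blast
  with assms(1) show ?thesis unfolding poly_multiple_def
    by (intro exI[of _ "\<lambda>n k. h n k * g n k"]) (simp add: lattice_poly_mult mult.assoc)
qed

lemma poly_multiple_mult:
  assumes "poly_multiple f T" "poly_multiple f' T'"
  shows "poly_multiple (\<lambda>n k. f n k * f' n k) (\<lambda>n k. T n k * T' n k)"
proof -
  obtain g g' where "lattice_poly g" "lattice_poly g'"
    and "\<And>n k. f n k = g n k * T n k" "\<And>n k. f' n k = g' n k * T' n k"
    using assms unfolding poly_multiple_def by blast
  then show ?thesis unfolding poly_multiple_def
    by (intro exI[of _ "\<lambda>n k. g n k * g' n k"]) (simp add: lattice_poly_mult mult_ac)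
qed

lemma poly_multiple_signed_sum:
  assumes "\<And>i. min 0 j \<le> i \<Longrightarrow> i < max 0 j \<Longrightarrow> poly_multiple (f i) T"
  shows "poly_multiple (\<lambda>n k. signed_sum j (\<lambda>i. f i n k)) T"
proof -
  have sum: "poly_multiple (\<lambda>n k. \<Sum>i\<in>I. f i n k) T" if "I \<subseteq> {min 0 j..<max 0 j}" for I
  proof -
    have "finite I" using that finite_subset by blast
    then show ?thesis using that
    proof (induction I)
      case empty
      then show ?case unfolding poly_multiple_def by (auto intro: lattice_poly_const)
    next
      case (insert i I)
      then show ?case by (auto intro!: poly_multiple_add assms)
    qed
  qed
  show ?thesis
  proof (cases "0 \<le> j")
    case True
    then show ?thesis using sum[of "{0..<j}"] by (simp add: signed_sum_def)
  next
    case False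
    then have "poly_multiple (\<lambda>n k. (-1) * (\<Sum>i\<in>{j..<0}. f i n k)) T"
      by (intro poly_multiple_lattice_poly_mult lattice_poly_const sum) auto
    with False show ?thesis by (simp add: signed_sum_def)
  qed
qed

lemma poly_multiple_Gamma:
  assumes "lattice_poly v" "j0 \<le> j" "\<And>n k. v n k + of_int j0 \<notin> \<int>\<^sub>\<le>\<^sub>0"
  shows "poly_multiple (\<lambda>n k. Gamma (v n k + of_int j)) (\<lambda>n k. Gamma (v n k + of_int j0))"
  unfolding poly_multiple_def
proof (intro exI conjI allI)
  define d where "d = nat (j - j0)"
  show "lattice_poly (\<lambda>n k. pochhammer (v n k + of_int j0) d)"
    by (intro lattice_poly_pochhammer lattice_poly_add assms(1) lattice_poly_const)
  fix n k
  have "of_int j = of_int j0 + (of_nat d :: complex)" using assms(2) by (simp add: d_def)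
  with pochhammer_Gamma[OF assms(3)] Gamma_nonzero[OF assms(3)]
  show "Gamma (v n k + of_int j) = pochhammer (v n k + of_int j0) d * Gamma (v n k + of_int j0)"
    by (simp add: add.assoc)
qed

lemma poly_multiple_rGamma:
  assumes "lattice_poly v" "j \<le> j0"
  shows "poly_multiple (\<lambda>n k. rGamma (v n k + of_int j)) (\<lambda>n k. rGamma (v n k + of_int j0))"
  unfolding poly_multiple_def
proof (intro exI conjI allI)
  define d where "d = nat (j0 - j)"
  show "lattice_poly (\<lambda>n k. pochhammer (v n k + of_int j) d)"
    by (intro lattice_poly_pochhammer lattice_poly_add assms(1) lattice_poly_const)
  fix n k
  have "of_int j0 = of_int j + (of_nat d :: complex)" using assms(2) by (simp add: d_def)
  then show "rGamma (v n k + of_int j)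
      = pochhammer (v n k + of_int j) d * rGamma (v n k + of_int j0)"
    using pochhammer_rGamma[of "v n k + of_int j" d] by (simp add: add.assoc)
qed

lemma poly_multiple_neg1pow:
  "poly_multiple (\<lambda>n k. neg1pow (v n k + of_int j)) (\<lambda>n k. neg1pow (v n k))"
  unfolding poly_multiple_def
  by (intro exI[of _ "\<lambda>n k. neg1pow (of_int j)"]) (simp add: lattice_poly_const neg1pow_add)

section \<open>Contiguous relations of the seed\<close>

definition F0_gen :: "int \<Rightarrow> seed_term" where
  "F0_gen s x a b c d
     = neg1pow (c + d) * Gamma (a + x) * Gamma (b + x) * rGamma (c + x) * rGamma (d + x)
     * Gamma (a + b - c - d + of_int s)
     * rGamma (a - c + 1) * rGamma (a - d + 1) * rGamma (b - c + 1) * rGamma (b - d + 1)"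

lemma F0_eq_F0_gen: "F0 x a b c d = F0_gen 2 x a b c d"
  by (simp add: F0_def F0_gen_def)

lemma F0_gen_swap_ab: "F0_gen s x b a c d = F0_gen s x a b c d"
  and F0_gen_swap_cd: "F0_gen s x a b d c = F0_gen s x a b c d"
  by (simp_all add: F0_gen_def add_ac mult_ac diff_diff_eq)

definition mate_a :: seed_term where
  "mate_a x a b c d = (b - c + 1) * (b - d + 1) * F0_gen 0 x a b (c - 1) (d - 1)"

definition mate_b :: seed_term where
  "mate_b x a b c d = (a - c + 1) * (a - d + 1) * F0_gen 0 x a b (c - 1) (d - 1)"

definition mate_c :: seed_term where
  "mate_c x a b c d = (a - d + 1) * (b - d + 1) * F0_gen 0 x a b c (d - 1)"

definition mate_d :: seed_term where
  "mate_d x a b c d = (a - c + 1) * (b - c + 1) * F0_gen 0 x a b (c - 1) d"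

lemma mate_a_swap: "mate_a x b a c d = mate_b x a b c d"
  by (simp add: mate_a_def mate_b_def F0_gen_swap_ab)

lemma mate_c_swap: "mate_c x a b d c = mate_d x a b c d"
  by (simp add: mate_c_def mate_d_def F0_gen_swap_cd)

lemma F0_swap_ab: "F0 x b a c d = F0 x a b c d"
  and F0_swap_cd: "F0 x a b d c = F0 x a b c d"
  by (simp_all add: F0_eq_F0_gen F0_gen_swap_ab F0_gen_swap_cd)

lemma neg1pow_minus1: "neg1pow (w - 1) = - neg1pow w"
  using neg1pow_plus1[of "w - 1"] by simp

lemma rGamma_minus1: "rGamma (z - 1) = (z - 1) * rGamma z"
  using rGamma_plus1[of "z - 1"] by simp

lemma rGamma_plus2: "rGamma (z + 1) = (z + 1) * rGamma (z + 2)"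
  using rGamma_plus1[of "z + 1"] by (simp add: add.assoc)

text \<open>Normalises the sums inside Gamma arguments without distributing products, so that
  polynomial prefactors stay factors.\<close>
lemmas Gamma_arg_simps = add_ac mult_ac diff_add_eq add_diff_eq diff_diff_eq diff_diff_eq2

lemma F0_step_a:
  assumes "a + x \<notin> \<int>\<^sub>\<le>\<^sub>0" "b + x \<notin> \<int>\<^sub>\<le>\<^sub>0" "a + b - c - d + 2 \<notin> \<int>\<^sub>\<le>\<^sub>0"
  shows "F0 x (a + 1) b c d - F0 x a b c d = mate_a (x + 1) a b c d - mate_a x a b c d"
proof -
  define S where "S = a + b - c - d + 2"
  define base where "base
    = neg1pow (c + d) * Gamma (a + x) * Gamma (b + x) * rGamma (c + x) * rGamma (d + x)
     * Gamma S * rGamma (a - c + 2) * rGamma (a - d + 2) * rGamma (b - c + 2) * rGamma (b - d + 2)"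
  have 1: "F0 x (a + 1) b c d = (a + x) * S * (b - c + 1) * (b - d + 1) * base"
    using Gamma_plus1[OF assms(1)] Gamma_plus1[OF assms(3)]
      rGamma_plus2[of "b - c"] rGamma_plus2[of "b - d"]
    unfolding F0_def base_def S_def by (simp add: Gamma_arg_simps)
  have 2: "F0 x a b c d = (a - c + 1) * (a - d + 1) * (b - c + 1) * (b - d + 1) * base"
    using rGamma_plus2[of "a - c"] rGamma_plus2[of "a - d"]
      rGamma_plus2[of "b - c"] rGamma_plus2[of "b - d"]
    unfolding F0_def base_def S_def by (simp add: Gamma_arg_simps)
  have 3: "mate_a (x + 1) a b c d = (b - c + 1) * (b - d + 1) * (a + x) * (b + x) * base"
    using Gamma_plus1[OF assms(1)] Gamma_plus1[OF assms(2)]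
      neg1pow_minus1[of "c + d"] neg1pow_minus1[of "c + d - 1"]
    unfolding mate_a_def F0_gen_def base_def S_def by (simp add: Gamma_arg_simps)
  have 4: "mate_a x a b c d = (b - c + 1) * (b - d + 1) * (c + x - 1) * (d + x - 1) * base"
    using rGamma_minus1[of "c + x"] rGamma_minus1[of "d + x"]
      neg1pow_minus1[of "c + d"] neg1pow_minus1[of "c + d - 1"]
    unfolding mate_a_def F0_gen_def base_def S_def by (simp add: Gamma_arg_simps)
  show ?thesis
    unfolding 1 2 3 4 S_def by (simp add: algebra_simps)
qed

lemma F0_step_c:
  assumes "a + x \<notin> \<int>\<^sub>\<le>\<^sub>0" "b + x \<notin> \<int>\<^sub>\<le>\<^sub>0" "a + b - c - d + 1 \<notin> \<int>\<^sub>\<le>\<^sub>0"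
  shows "F0 x a b (c + 1) d - F0 x a b c d = mate_c (x + 1) a b c d - mate_c x a b c d"
proof -
  define S where "S = a + b - c - d + 1"
  define base where "base
    = neg1pow (c + d) * Gamma (a + x) * Gamma (b + x) * rGamma (c + x + 1) * rGamma (d + x)
     * Gamma S * rGamma (a - c + 1) * rGamma (a - d + 2) * rGamma (b - c + 1) * rGamma (b - d + 2)"
  have 1: "F0 x a b (c + 1) d = - ((a - c) * (b - c) * (a - d + 1) * (b - d + 1) * base)"
    using neg1pow_plus1[of "c + d"]
      rGamma_plus1[of "a - c", symmetric] rGamma_plus1[of "b - c", symmetric]
      rGamma_plus2[of "a - d"] rGamma_plus2[of "b - d"]
    unfolding F0_def base_def S_def by (simp add: Gamma_arg_simps)
  have 2: "F0 x a b c d = (c + x) * S * (a - d + 1) * (b - d + 1) * base"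
    using rGamma_plus1[of "c + x", symmetric] Gamma_plus1[OF assms(3)]
      rGamma_plus2[of "a - d"] rGamma_plus2[of "b - d"]
    unfolding F0_def base_def S_def by (simp add: Gamma_arg_simps)
  have 3: "mate_c (x + 1) a b c d = - ((a - d + 1) * (b - d + 1) * (a + x) * (b + x) * base)"
    using Gamma_plus1[OF assms(1)] Gamma_plus1[OF assms(2)] neg1pow_minus1[of "c + d"]
    unfolding mate_c_def F0_gen_def base_def S_def by (simp add: Gamma_arg_simps)
  have 4: "mate_c x a b c d = - ((a - d + 1) * (b - d + 1) * (c + x) * (d + x - 1) * base)"
    using rGamma_plus1[of "c + x", symmetric] rGamma_minus1[of "d + x"] neg1pow_minus1[of "c + d"]
    unfolding mate_c_def F0_gen_def base_def S_def by (simp add: Gamma_arg_simps)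
  show ?thesis
    unfolding 1 2 3 4 S_def by (simp add: algebra_simps)
qed

lemma not_in_nonpos_Ints_shift:
  assumes "z \<notin> \<int>\<^sub>\<le>\<^sub>0" "0 \<le> i"
  shows "z + of_int i \<notin> \<int>\<^sub>\<le>\<^sub>0"
proof
  assume "z + of_int i \<in> \<int>\<^sub>\<le>\<^sub>0"
  then obtain t where "t \<le> 0" "z + of_int i = of_int t" by (auto elim!: nonpos_Ints_cases)
  then have "z = of_int (t - i)" "t - i \<le> 0" using assms(2) by (simp_all add: algebra_simps)
  with assms(1) show False using nonpos_Ints_of_int by blast
qed

lemma not_in_Ints_shift: "z \<notin> \<int> \<Longrightarrow> z + of_int i \<notin> \<int>\<^sub>\<le>\<^sub>0"
  by (metis Ints_diff Ints_of_int add_diff_cancel_right' nonpos_Ints_Int)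

lemma not_in_Ints_shift_left:
  assumes "z + x \<notin> \<int>"
  shows "z + of_int i + x \<notin> \<int>"
proof
  assume "z + of_int i + x \<in> \<int>"
  moreover have "z + x = (z + of_int i + x) - of_int i" by simp
  ultimately show False using assms by (metis Ints_diff Ints_of_int)
qed

lemma F0_move_a:
  assumes "a + x \<notin> \<int>" "b + x \<notin> \<int>" "a + b - c - d + 2 + of_int (min 0 j) \<notin> \<int>\<^sub>\<le>\<^sub>0"
  shows "F0 x (a + of_int j) b c d - F0 x a b c d
       = signed_sum j (\<lambda>i. mate_a (x + 1) (a + of_int i) b c d)
         - signed_sum j (\<lambda>i. mate_a x (a + of_int i) b c d)"
proof -
  have "F0 x (a + of_int j) b c d - F0 x (a + of_int 0) b c d
      = signed_sum j (\<lambda>i. mate_a (x + 1) (a + of_int i) b c d - mate_a x (a + of_int i) b c d)"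
  proof (rule signed_sum_telescope)
    fix i assume "min 0 j \<le> i" "i < max 0 j"
    then have "a + b - c - d + 2 + of_int (min 0 j) + of_int (i - min 0 j) \<notin> \<int>\<^sub>\<le>\<^sub>0"
      by (intro not_in_nonpos_Ints_shift assms(3)) simp
    moreover have "a + x + of_int i \<notin> \<int>\<^sub>\<le>\<^sub>0" "b + x \<notin> \<int>\<^sub>\<le>\<^sub>0"
      using not_in_Ints_shift[OF assms(1)] not_in_Ints_imp_not_in_nonpos_Ints[OF assms(2)] by blast+
    ultimately show "F0 x (a + of_int (i + 1)) b c d - F0 x (a + of_int i) b c d
        = mate_a (x + 1) (a + of_int i) b c d - mate_a x (a + of_int i) b c d"
      using F0_step_a[of "a + of_int i" x b c d] by (simp add: algebra_simps)
  qed
  then show ?thesis by (simp add: signed_sum_diff)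
qed

lemma F0_move_b:
  assumes "a + x \<notin> \<int>" "b + x \<notin> \<int>" "a + b - c - d + 2 + of_int (min 0 j) \<notin> \<int>\<^sub>\<le>\<^sub>0"
  shows "F0 x a (b + of_int j) c d - F0 x a b c d
       = signed_sum j (\<lambda>i. mate_b (x + 1) a (b + of_int i) c d)
         - signed_sum j (\<lambda>i. mate_b x a (b + of_int i) c d)"
  using F0_move_a[of b x a c d j] assms by (simp add: F0_swap_ab mate_a_swap add.commute)

lemma F0_move_c:
  assumes "a + x \<notin> \<int>" "b + x \<notin> \<int>" "a + b - c - d + 2 - of_int (max 0 j) \<notin> \<int>\<^sub>\<le>\<^sub>0"
  shows "F0 x a b (c + of_int j) d - F0 x a b c d
       = signed_sum j (\<lambda>i. mate_c (x + 1) a b (c + of_int i) d)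
         - signed_sum j (\<lambda>i. mate_c x a b (c + of_int i) d)"
proof -
  have "F0 x a b (c + of_int j) d - F0 x a b (c + of_int 0) d
      = signed_sum j (\<lambda>i. mate_c (x + 1) a b (c + of_int i) d - mate_c x a b (c + of_int i) d)"
  proof (rule signed_sum_telescope)
    fix i assume "min 0 j \<le> i" "i < max 0 j"
    then have "a + b - c - d + 2 - of_int (max 0 j) + of_int (max 0 j - i - 1) \<notin> \<int>\<^sub>\<le>\<^sub>0"
      by (intro not_in_nonpos_Ints_shift assms(3)) simp
    moreover have "a + x \<notin> \<int>\<^sub>\<le>\<^sub>0" "b + x \<notin> \<int>\<^sub>\<le>\<^sub>0"
      using assms(1,2) by (simp_all add: not_in_Ints_imp_not_in_nonpos_Ints)
    ultimately show "F0 x a b (c + of_int (i + 1)) d - F0 x a b (c + of_int i) d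
        = mate_c (x + 1) a b (c + of_int i) d - mate_c x a b (c + of_int i) d"
      using F0_step_c[of a x b "c + of_int i" d] by (simp add: algebra_simps)
  qed
  then show ?thesis by (simp add: signed_sum_diff)
qed

lemma F0_move_d:
  assumes "a + x \<notin> \<int>" "b + x \<notin> \<int>" "a + b - c - d + 2 - of_int (max 0 j) \<notin> \<int>\<^sub>\<le>\<^sub>0"
  shows "F0 x a b c (d + of_int j) - F0 x a b c d
       = signed_sum j (\<lambda>i. mate_d (x + 1) a b c (d + of_int i))
         - signed_sum j (\<lambda>i. mate_d x a b c (d + of_int i))"
  using F0_move_c[of a x b d c j] assms by (simp add: F0_swap_cd mate_c_swap algebra_simps)

lemma F0_move_x:
  "F0 (x + of_int j) a b c d - F0 x a b c d
     = signed_sum j (\<lambda>i. F0 (x + 1 + of_int i) a b c d)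
       - signed_sum j (\<lambda>i. F0 (x + of_int i) a b c d)"
proof -
  have "F0 (x + of_int j) a b c d - F0 (x + of_int 0) a b c d
      = signed_sum j (\<lambda>i. F0 (x + 1 + of_int i) a b c d - F0 (x + of_int i) a b c d)"
    by (rule signed_sum_telescope) (simp add: algebra_simps)
  then show ?thesis by (simp add: signed_sum_diff)
qed

lemma not_in_nonpos_Ints_between:
  assumes "z \<notin> \<int>\<^sub>\<le>\<^sub>0" "z + of_int m \<notin> \<int>\<^sub>\<le>\<^sub>0" "min 0 m \<le> i"
  shows "z + of_int i \<notin> \<int>\<^sub>\<le>\<^sub>0"
proof (cases "0 \<le> i")
  case True
  then show ?thesis using not_in_nonpos_Ints_shift[OF assms(1)] by blast
next
  case False
  then have "z + of_int m + of_int (i - m) \<notin> \<int>\<^sub>\<le>\<^sub>0"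
    using assms(3) by (intro not_in_nonpos_Ints_shift[OF assms(2)]) simp
  then show ?thesis by simp
qed

definition mate_move :: "int \<Rightarrow> int \<Rightarrow> int \<Rightarrow> int \<Rightarrow> seed_term" where
  "mate_move ja jb jc jd x a b c d =
       signed_sum ja (\<lambda>i. mate_a x (a + of_int i) b c d)
     + signed_sum jb (\<lambda>i. mate_b x (a + of_int ja) (b + of_int i) c d)
     + signed_sum jc (\<lambda>i. mate_c x (a + of_int ja) (b + of_int jb) (c + of_int i) d)
     + signed_sum jd (\<lambda>i. mate_d x (a + of_int ja) (b + of_int jb) (c + of_int jc) (d + of_int i))"

lemma F0_move_monotone:
  assumes "a + x \<notin> \<int>" "b + x \<notin> \<int>"
    and "a + b - c - d + 2 \<notin> \<int>\<^sub>\<le>\<^sub>0" "a + b - c - d + 2 + of_int (ja + jb - jc - jd) \<notin> \<int>\<^sub>\<le>\<^sub>0"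
    and "(0 \<le> ja \<and> 0 \<le> jb \<and> jc \<le> 0 \<and> jd \<le> 0) \<or> (ja \<le> 0 \<and> jb \<le> 0 \<and> 0 \<le> jc \<and> 0 \<le> jd)"
  shows "F0 x (a + of_int ja) (b + of_int jb) (c + of_int jc) (d + of_int jd) - F0 x a b c d
       = mate_move ja jb jc jd (x + 1) a b c d - mate_move ja jb jc jd x a b c d"
proof -
  have S: "a + b - c - d + 2 + of_int i \<notin> \<int>\<^sub>\<le>\<^sub>0" if "min 0 (ja + jb - jc - jd) \<le> i" for i
    using not_in_nonpos_Ints_between[OF assms(3,4) that] .
  have "min 0 (ja + jb - jc - jd) \<le> min 0 ja" "min 0 (ja + jb - jc - jd) \<le> ja + min 0 jb"
    "min 0 (ja + jb - jc - jd) \<le> ja + jb - max 0 jc"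
    "min 0 (ja + jb - jc - jd) \<le> ja + jb - jc - max 0 jd"
    using assms(5) by auto
  from S[OF this(1)] S[OF this(2)] S[OF this(3)] S[OF this(4)]
  have Sa: "a + b - c - d + 2 + of_int (min 0 ja) \<notin> \<int>\<^sub>\<le>\<^sub>0"
    and Sb: "a + of_int ja + b - c - d + 2 + of_int (min 0 jb) \<notin> \<int>\<^sub>\<le>\<^sub>0"
    and Sc: "a + of_int ja + (b + of_int jb) - c - d + 2 - of_int (max 0 jc) \<notin> \<int>\<^sub>\<le>\<^sub>0"
    and Sd: "a + of_int ja + (b + of_int jb) - (c + of_int jc) - d + 2 - of_int (max 0 jd) \<notin> \<int>\<^sub>\<le>\<^sub>0"
    by (simp_all add: algebra_simps)
  note shift_a = not_in_Ints_shift_left[OF assms(1)]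
    and shift_b = not_in_Ints_shift_left[OF assms(2)]
  have "F0 x (a + of_int ja) (b + of_int jb) (c + of_int jc) (d + of_int jd) - F0 x a b c d
      = (F0 x (a + of_int ja) b c d - F0 x a b c d)
      + (F0 x (a + of_int ja) (b + of_int jb) c d - F0 x (a + of_int ja) b c d)
      + (F0 x (a + of_int ja) (b + of_int jb) (c + of_int jc) d
         - F0 x (a + of_int ja) (b + of_int jb) c d)
      + (F0 x (a + of_int ja) (b + of_int jb) (c + of_int jc) (d + of_int jd)
         - F0 x (a + of_int ja) (b + of_int jb) (c + of_int jc) d)"
    by simp
  also have "\<dots> = mate_move ja jb jc jd (x + 1) a b c d - mate_move ja jb jc jd x a b c d"
    unfolding F0_move_a[OF assms(1,2) Sa] F0_move_b[OF shift_a assms(2) Sb]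
      F0_move_c[OF shift_a shift_b Sc] F0_move_d[OF shift_a shift_b Sd]
    by (simp add: mate_move_def)
  finally show ?thesis .
qed

definition F0_mate :: "int \<Rightarrow> int \<Rightarrow> int \<Rightarrow> int \<Rightarrow> int \<Rightarrow> seed_term" where
  "F0_mate K A B C D x a b c d =
     (let A1 = max A 0; B1 = max B 0; C1 = min C 0; D1 = min D 0 in
        mate_move A1 B1 C1 D1 x a b c d
      + mate_move (A - A1) (B - B1) (C - C1) (D - D1) x
          (a + of_int A1) (b + of_int B1) (c + of_int C1) (d + of_int D1)
      + signed_sum K (\<lambda>i. F0 (x + of_int i)
          (a + of_int A) (b + of_int B) (c + of_int C) (d + of_int D)))"

lemma F0_mate_wz:
  assumes "a + x \<notin> \<int>" "b + x \<notin> \<int>"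
    and "a + b - c - d + 2 \<notin> \<int>\<^sub>\<le>\<^sub>0" "a + b - c - d + 2 + of_int (A + B - C - D) \<notin> \<int>\<^sub>\<le>\<^sub>0"
  shows "F0 (x + of_int K) (a + of_int A) (b + of_int B) (c + of_int C) (d + of_int D) - F0 x a b c d
       = F0_mate K A B C D (x + 1) a b c d - F0_mate K A B C D x a b c d"
proof -
  define A1 B1 C1 D1 where "A1 = max A 0" and "B1 = max B 0" and "C1 = min C 0" and "D1 = min D 0"
  define a1 b1 c1 d1 where "a1 = a + of_int A1" and "b1 = b + of_int B1"
    and "c1 = c + of_int C1" and "d1 = d + of_int D1"
  note defs = A1_def B1_def C1_def D1_def a1_def b1_def c1_def d1_def
  have top: "a1 + b1 - c1 - d1 + 2 \<notin> \<int>\<^sub>\<le>\<^sub>0"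
    using not_in_nonpos_Ints_between[OF assms(3,4), of "A1 + B1 - C1 - D1"]
    by (simp add: defs algebra_simps)
  have phase1: "F0 x a1 b1 c1 d1 - F0 x a b c d
      = mate_move A1 B1 C1 D1 (x + 1) a b c d - mate_move A1 B1 C1 D1 x a b c d"
    unfolding a1_def b1_def c1_def d1_def
    by (rule F0_move_monotone) (use assms(1-3) top in \<open>simp_all add: defs algebra_simps\<close>)
  have phase2: "F0 x (a1 + of_int (A - A1)) (b1 + of_int (B - B1))
          (c1 + of_int (C - C1)) (d1 + of_int (D - D1)) - F0 x a1 b1 c1 d1
      = mate_move (A - A1) (B - B1) (C - C1) (D - D1) (x + 1) a1 b1 c1 d1
        - mate_move (A - A1) (B - B1) (C - C1) (D - D1) x a1 b1 c1 d1"
    by (rule F0_move_monotone)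
      (use assms not_in_Ints_shift_left[OF assms(1)] not_in_Ints_shift_left[OF assms(2)] top
        in \<open>simp_all add: defs algebra_simps\<close>)
  have ends: "a1 + of_int (A - A1) = a + of_int A" "b1 + of_int (B - B1) = b + of_int B"
    "c1 + of_int (C - C1) = c + of_int C" "d1 + of_int (D - D1) = d + of_int D"
    by (simp_all add: defs)
  let ?e = "F0 x (a + of_int A) (b + of_int B) (c + of_int C) (d + of_int D)"
  have "F0 (x + of_int K) (a + of_int A) (b + of_int B) (c + of_int C) (d + of_int D) - F0 x a b c d
      = (F0 (x + of_int K) (a + of_int A) (b + of_int B) (c + of_int C) (d + of_int D) - ?e)
      + (?e - F0 x a1 b1 c1 d1) + (F0 x a1 b1 c1 d1 - F0 x a b c d)"
    by simp
  also have "\<dots> = F0_mate K A B C D (x + 1) a b c d - F0_mate K A B C D x a b c d"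
    unfolding F0_move_x phase1 phase2[unfolded ends]
    by (simp add: F0_mate_def Let_def defs algebra_simps)
  finally show ?thesis .
qed

section \<open>The seed along a line of the lattice\<close>

lemma add_of_int_minus1: "z + of_int p - 1 = z + of_int (p - 1)"
  by simp

locale F0_specialization =
  fixes K A B C D :: int and k0 a b c d :: complex
  assumes no_poles: "\<forall>n k :: int.
      of_int (K * n + k) + k0 + of_int (A * n) + a \<notin> \<int>\<^sub>\<le>\<^sub>0 \<and>
      of_int (K * n + k) + k0 + of_int (B * n) + b \<notin> \<int>\<^sub>\<le>\<^sub>0 \<and>
      (of_int (A * n) + a) + (of_int (B * n) + b) - (of_int (C * n) + c) - (of_int (D * n) + d) + 2
        \<notin> \<int>\<^sub>\<le>\<^sub>0"
begin

definition X :: lattice_term where "X n k = of_int (K * n) + k0 + of_int k"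
definition Ya :: "int \<Rightarrow> complex" where "Ya n = of_int (A * n) + a"
definition Yb :: "int \<Rightarrow> complex" where "Yb n = of_int (B * n) + b"
definition Yc :: "int \<Rightarrow> complex" where "Yc n = of_int (C * n) + c"
definition Yd :: "int \<Rightarrow> complex" where "Yd n = of_int (D * n) + d"
definition S :: "int \<Rightarrow> complex" where "S n = Ya n + Yb n - Yc n - Yd n + 2"

lemma Y_X_not_Ints: "Ya n + X n k \<notin> \<int>" "Yb n + X n k \<notin> \<int>"
proof -
  have *: "y + X n k \<notin> \<int>" if "\<And>k. X n k + y \<notin> \<int>\<^sub>\<le>\<^sub>0" for y
  proof
    assume "y + X n k \<in> \<int>"
    then obtain t where "y + X n k = of_int t" by (auto elim: Ints_cases)
    then have "X n (k - t) + y = 0" by (simp add: X_def algebra_simps)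
    with that[of "k - t"] show False by simp
  qed
  have "X n k + Ya n \<notin> \<int>\<^sub>\<le>\<^sub>0" "X n k + Yb n \<notin> \<int>\<^sub>\<le>\<^sub>0" for k
    using no_poles[rule_format, of n k] by (simp_all add: X_def Ya_def Yb_def algebra_simps)
  then show "Ya n + X n k \<notin> \<int>" "Yb n + X n k \<notin> \<int>"
    by (simp_all add: *)
qed

lemma S_not_nonpos_Ints: "S n \<notin> \<int>\<^sub>\<le>\<^sub>0"
  using no_poles by (simp add: S_def Ya_def Yb_def Yc_def Yd_def)

lemma S_succ: "S (n + 1) = S n + of_int (A + B - C - D)"
  by (simp add: S_def Ya_def Yb_def Yc_def Yd_def algebra_simps)

definition G :: lattice_term where
  "G n k = F0_mate K A B C D (X n k) (Ya n) (Yb n) (Yc n) (Yd n)"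

lemma wz_pair_G: "wz_pair (\<lambda>n k. F0 (X n k) (Ya n) (Yb n) (Yc n) (Yd n)) G"
  unfolding wz_pair_def
proof (intro allI)
  fix n k
  have "X (n + 1) k = X n k + of_int K" "X n (k + 1) = X n k + 1"
    "Ya (n + 1) = Ya n + of_int A" "Yb (n + 1) = Yb n + of_int B"
    "Yc (n + 1) = Yc n + of_int C" "Yd (n + 1) = Yd n + of_int D"
    by (simp_all add: X_def Ya_def Yb_def Yc_def Yd_def algebra_simps)
  with F0_mate_wz[OF Y_X_not_Ints S_not_nonpos_Ints[of n, unfolded S_def]
      S_not_nonpos_Ints[of "n + 1", unfolded S_succ, unfolded S_def]]
  show "F0 (X (n + 1) k) (Ya (n + 1)) (Yb (n + 1)) (Yc (n + 1)) (Yd (n + 1))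
      - F0 (X n k) (Ya n) (Yb n) (Yc n) (Yd n)
      = G n (k + 1) - G n k"
    by (simp add: G_def)
qed

lemma lattice_affine_X: "lattice_affine X"
  unfolding lattice_affine_def X_def by (rule exI[of _ K], rule exI[of _ 1], rule exI[of _ k0]) simp

lemma lattice_affine_Y:
  "lattice_affine (\<lambda>n k. Ya n)" "lattice_affine (\<lambda>n k. Yb n)"
  "lattice_affine (\<lambda>n k. Yc n)" "lattice_affine (\<lambda>n k. Yd n)"
  unfolding Ya_def Yb_def Yc_def Yd_def by (rule lattice_affine_linear)+

lemma lattice_affine_S: "lattice_affine (\<lambda>n k. S n)"
  unfolding S_def
  by (intro lattice_affine_add lattice_affine_diff lattice_affine_Y lattice_affine_const)

definition M :: int where "M = \<bar>K\<bar> + \<bar>A\<bar> + \<bar>B\<bar> + \<bar>C\<bar> + \<bar>D\<bar>"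
definition N :: int where "N = 2 * M + 3"
definition m0 :: int where "m0 = min 0 (A + B - C - D)"

lemma S_shift_not_nonpos_Ints: "m0 \<le> i \<Longrightarrow> S n + of_int i \<notin> \<int>\<^sub>\<le>\<^sub>0"
  using not_in_nonpos_Ints_between
      [OF S_not_nonpos_Ints S_not_nonpos_Ints[of "n + 1", unfolded S_succ]]
  by (simp add: m0_def)

text \<open>Every Gamma argument of \<open>F\<^sub>0\<close> moved down, and every reciprocal Gamma argument moved up,
  far enough that each term of the mate \<open>G\<close> is a polynomial multiple of \<open>T\<close>.\<close>
definition T :: lattice_term where
  "T n k = neg1pow (Yc n + Yd n)
     * Gamma (X n k + Ya n + of_int (- N)) * Gamma (X n k + Yb n + of_int (- N))
     * rGamma (X n k + Yc n + of_int N) * rGamma (X n k + Yd n + of_int N) * Gamma (S n + of_int m0)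
     * rGamma (Ya n - Yc n + of_int N) * rGamma (Ya n - Yd n + of_int N)
     * rGamma (Yb n - Yc n + of_int N) * rGamma (Yb n - Yd n + of_int N)"

lemma X_Y_shift_not_nonpos_Ints:
  "X n k + Ya n + of_int i \<notin> \<int>\<^sub>\<le>\<^sub>0" "X n k + Yb n + of_int i \<notin> \<int>\<^sub>\<le>\<^sub>0"
  using not_in_Ints_shift[OF Y_X_not_Ints(1)] not_in_Ints_shift[OF Y_X_not_Ints(2)]
  by (simp_all add: add.commute)

lemma hypergeometric2_T: "hypergeometric2 T"
  unfolding T_def[abs_def]
  by (intro hypergeometric2_mult hypergeometric2_neg1pow hypergeometric2_rGamma
      hypergeometric2_Gamma lattice_affine_add lattice_affine_diff lattice_affine_const
      lattice_affine_X lattice_affine_Y lattice_affine_S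
      X_Y_shift_not_nonpos_Ints S_shift_not_nonpos_Ints) (simp add: m0_def)

definition shifted :: "seed_term \<Rightarrow> int \<Rightarrow> int \<Rightarrow> int \<Rightarrow> int \<Rightarrow> int \<Rightarrow> lattice_term" where
  "shifted f p0 p1 p2 p3 p4 n k
     = f (X n k + of_int p0)
         (Ya n + of_int p1) (Yb n + of_int p2) (Yc n + of_int p3) (Yd n + of_int p4)"

lemma shifted_F0_gen_poly_multiple:
  assumes "\<bar>p0\<bar> \<le> M + 1" "\<bar>p1\<bar> \<le> M + 1" "\<bar>p2\<bar> \<le> M + 1" "\<bar>p3\<bar> \<le> M + 1" "\<bar>p4\<bar> \<le> M + 1"
    and "m0 \<le> p1 + p2 - p3 - p4 + s - 2"
  shows "poly_multiple (shifted (F0_gen s) p0 p1 p2 p3 p4) T"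
proof -
  have "shifted (F0_gen s) p0 p1 p2 p3 p4 = (\<lambda>n k. neg1pow (Yc n + Yd n + of_int (p3 + p4))
     * Gamma (X n k + Ya n + of_int (p0 + p1)) * Gamma (X n k + Yb n + of_int (p0 + p2))
     * rGamma (X n k + Yc n + of_int (p0 + p3)) * rGamma (X n k + Yd n + of_int (p0 + p4))
     * Gamma (S n + of_int (p1 + p2 - p3 - p4 + s - 2))
     * rGamma (Ya n - Yc n + of_int (p1 - p3 + 1)) * rGamma (Ya n - Yd n + of_int (p1 - p4 + 1))
     * rGamma (Yb n - Yc n + of_int (p2 - p3 + 1)) * rGamma (Yb n - Yd n + of_int (p2 - p4 + 1)))"
    by (simp add: fun_eq_iff shifted_def F0_gen_def S_def algebra_simps)
  moreover have "poly_multiple \<dots> T"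
    unfolding T_def[abs_def] using assms
    by (intro poly_multiple_mult poly_multiple_neg1pow poly_multiple_Gamma poly_multiple_rGamma
        lattice_affine_lattice_poly lattice_affine_add lattice_affine_diff
        lattice_affine_X lattice_affine_Y
        lattice_affine_S X_Y_shift_not_nonpos_Ints S_shift_not_nonpos_Ints order_refl)
      (auto simp: N_def)
  ultimately show ?thesis by simp
qed

lemma lattice_poly_Y:
  "lattice_poly (\<lambda>n k. Ya n)" "lattice_poly (\<lambda>n k. Yb n)"
  "lattice_poly (\<lambda>n k. Yc n)" "lattice_poly (\<lambda>n k. Yd n)"
  by (intro lattice_affine_lattice_poly lattice_affine_Y)+

lemma shifted_mates_poly_multiple:
  assumes "\<bar>p0\<bar> \<le> M" "\<bar>p1\<bar> \<le> M" "\<bar>p2\<bar> \<le> M" "\<bar>p3\<bar> \<le> M" "\<bar>p4\<bar> \<le> M"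
  shows "m0 \<le> p1 + p2 - p3 - p4 \<Longrightarrow> poly_multiple (shifted F0 p0 p1 p2 p3 p4) T"
    and "m0 \<le> p1 + p2 - p3 - p4 \<Longrightarrow> poly_multiple (shifted mate_a p0 p1 p2 p3 p4) T"
    and "m0 \<le> p1 + p2 - p3 - p4 \<Longrightarrow> poly_multiple (shifted mate_b p0 p1 p2 p3 p4) T"
    and "m0 \<le> p1 + p2 - p3 - p4 - 1 \<Longrightarrow> poly_multiple (shifted mate_c p0 p1 p2 p3 p4) T"
    and "m0 \<le> p1 + p2 - p3 - p4 - 1 \<Longrightarrow> poly_multiple (shifted mate_d p0 p1 p2 p3 p4) T"
  unfolding shifted_def F0_eq_F0_gen mate_a_def mate_b_def mate_c_def mate_d_def add_of_int_minus1
  using assms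
  by (intro poly_multiple_lattice_poly_mult shifted_F0_gen_poly_multiple[unfolded shifted_def]
      lattice_poly_mult lattice_poly_add lattice_poly_diff lattice_poly_Y lattice_poly_const; auto)+

lemma G_eq:
  defines "A1 \<equiv> max A 0" and "B1 \<equiv> max B 0" and "C1 \<equiv> min C 0" and "D1 \<equiv> min D 0"
  shows "G = (\<lambda>n k.
      signed_sum A1 (\<lambda>i. shifted mate_a 0 i 0 0 0 n k)
    + signed_sum B1 (\<lambda>i. shifted mate_b 0 A1 i 0 0 n k)
    + signed_sum C1 (\<lambda>i. shifted mate_c 0 A1 B1 i 0 n k)
    + signed_sum D1 (\<lambda>i. shifted mate_d 0 A1 B1 C1 i n k)
    + signed_sum (A - A1) (\<lambda>i. shifted mate_a 0 (A1 + i) B1 C1 D1 n k)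
    + signed_sum (B - B1) (\<lambda>i. shifted mate_b 0 A (B1 + i) C1 D1 n k)
    + signed_sum (C - C1) (\<lambda>i. shifted mate_c 0 A B (C1 + i) D1 n k)
    + signed_sum (D - D1) (\<lambda>i. shifted mate_d 0 A B C (D1 + i) n k)
    + signed_sum K (\<lambda>i. shifted F0 i A B C D n k))"
  by (simp add: fun_eq_iff G_def F0_mate_def mate_move_def Let_def shifted_def assms add.assoc)

lemma G_poly_multiple: "poly_multiple G T"
  unfolding G_eq
  by (intro poly_multiple_add poly_multiple_signed_sum shifted_mates_poly_multiple)
    (auto simp: M_def m0_def)

lemma has_wz_mate: "has_wz_mate (\<lambda>n k. F0 (X n k) (Ya n) (Yb n) (Yc n) (Yd n))"
  unfolding has_wz_mate_def
  using hypergeometric2_poly_multiple[OF G_poly_multiple hypergeometric2_T] wz_pair_G by blast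

end

theorem theorem1:
  fixes K A B C D :: int and k0 a b c d :: complex
  assumes "\<forall>n k :: int.
      of_int (K * n + k) + k0 + of_int (A * n) + a \<notin> \<int>\<^sub>\<le>\<^sub>0 \<and>
      of_int (K * n + k) + k0 + of_int (B * n) + b \<notin> \<int>\<^sub>\<le>\<^sub>0 \<and>
      (of_int (A * n) + a) + (of_int (B * n) + b) - (of_int (C * n) + c) - (of_int (D * n) + d) + 2
        \<notin> \<int>\<^sub>\<le>\<^sub>0"
  shows "has_wz_mate (\<lambda>n k. F0 (of_int (K * n) + k0 + of_int k)
                               (of_int (A * n) + a) (of_int (B * n) + b)
                               (of_int (C * n) + c) (of_int (D * n) + d))"
proof -
  interpret F0_specialization K A B C D k0 a b c d
    using assms by unfold_locales
  show ?thesis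
    using has_wz_mate unfolding X_def Ya_def Yb_def Yc_def Yd_def .
qed

end
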